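(* Let $N\ge 2$ and let $\Omega\subset\mathbb{R}^N$ be a smooth bounded domain. Let $\Psi:\overline\Omega\times(0,\infty)\to\mathbb{R}$ be a continuous function such that for each $x\in\Omega$ the mapping $(0,\infty)\ni s\mapsto \Psi(x,s)/s$ is strictly decreasing. Assume that there exist $v,w\in C^2(\Omega)\cap C(\overline\Omega)$ such that (a) $\Delta w+\Psi(x,w)\le 0\le \Delta v+\Psi(x,v)$ in $\Omega$; (b) $v,w>0$ in $\Omega$ and $v\le w$ on $\partial\Omega$; (c) $\Delta v\in L^1(\Omega)$ or $\Delta w\in L^1(\Omega)$. Then $v\le w$ in $\Omega$.
   Context: Here $\Psi(x,w)$ and $\Psi(x,v)$ denote $\Psi(x,w(x))$ and $\Psi(x,v(x))$, and the inequalities in (a) hold pointwise in $\Omega$. *)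

theory Defs
  imports "HOL-Analysis.Analysis"
begin

definition partial_derivative ::
    "'a::euclidean_space \<Rightarrow> ('a \<Rightarrow> 'b::real_normed_vector) \<Rightarrow> 'a \<Rightarrow> 'b" where
  "partial_derivative b f x = frechet_derivative f (at x) b"

text \<open>The class C^k on a set S, intended for open S. The derivatives are taken in the full space,
  so no regularity up to the boundary of S is imposed.\<close>

fun Ck_on :: "nat \<Rightarrow> 'a::euclidean_space set \<Rightarrow> ('a \<Rightarrow> 'b::real_normed_vector) \<Rightarrow> bool" where
  "Ck_on 0 S f \<longleftrightarrow> continuous_on S f"
| "Ck_on (Suc k) S f \<longleftrightarrow>
     (\<forall>x\<in>S. f differentiable (at x)) \<and> (\<forall>b\<in>Basis. Ck_on k S (partial_derivative b f))"

definition smooth_on :: "'a::euclidean_space set \<Rightarrow> ('a \<Rightarrow> 'b::real_normed_vector) \<Rightarrow> bool" where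
  "smooth_on S f \<longleftrightarrow> (\<forall>k. Ck_on k S f)"

definition laplacian :: "('a::euclidean_space \<Rightarrow> real) \<Rightarrow> 'a \<Rightarrow> real" where
  "laplacian f x = (\<Sum>b\<in>Basis. partial_derivative b (partial_derivative b f) x)"

text \<open>The boundary is locally straightened by C^infinity diffeomorphisms that take the domain to
  one side of a coordinate hyperplane.\<close>

definition smooth_boundary :: "'a::euclidean_space set \<Rightarrow> bool" where
  "smooth_boundary \<Omega> \<longleftrightarrow>
     (\<forall>p\<in>frontier \<Omega>. \<exists>U D \<phi> \<psi>. \<exists>e\<in>(Basis :: 'a set).
        open U \<and> p \<in> U \<and> open D \<and> homeomorphism U D \<phi> \<psi> \<and>
        smooth_on U \<phi> \<and> smooth_on D \<psi> \<and>
        \<phi> ` (U \<inter> \<Omega>) = D \<inter> {y. y \<bullet> e > 0} \<and>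
        \<phi> ` (U \<inter> frontier \<Omega>) = D \<inter> {y. y \<bullet> e = 0})"

definition smooth_bounded_domain :: "'a::euclidean_space set \<Rightarrow> bool" where
  "smooth_bounded_domain \<Omega> \<longleftrightarrow>
     \<Omega> \<noteq> {} \<and> open \<Omega> \<and> connected \<Omega> \<and> bounded \<Omega> \<and> smooth_boundary \<Omega>"

end

theory Submission
  imports Defs
begin

text \<open>
  Put \<open>u = v - w\<close> and suppose that \<open>u\<close> is positive somewhere. Where \<open>u > 0\<close>, the two
  differential inequalities and the monotonicity of \<open>\<Psi>(x,s)/s\<close> give
  \<open>W = w \<Delta>v - v \<Delta>w \<ge> v w (\<Psi>(x,w)/w - \<Psi>(x,v)/v) > 0\<close>.
  The aim is to see that the integral of \<open>W\<close> over \<open>{u > 0}\<close> cannot be positive, in the spirit of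
  Kato's inequality.

  For a convex \<open>C\<^sup>2\<close> function \<open>H\<close> that vanishes on \<open>(-\<infinity>, \<epsilon>]\<close>, the vector field
  \<open>X = f \<nabla>(H \<circ> u) - (H \<circ> u) \<nabla>f\<close> has its support in the set \<open>{u \<ge> \<epsilon>}\<close>, which is a compact
  subset of the open domain because \<open>u \<le> 0\<close> on the boundary. So no boundary term arises
  and the integral of \<open>div X\<close> vanishes. Both for
  \<open>f = v\<close> and for \<open>f = w\<close> one has \<open>f \<Delta>u - u \<Delta>f = W\<close>, and hence
  \<open>div X = H'(u) W + f H''(u) |\<nabla>u|\<^sup>2 + (u H'(u) - H(u)) \<Delta>f\<close>.
  The middle term is nonnegative. If moreover \<open>|u H'(u) - H(u)| \<le> 3 \<epsilon>\<close>, it follows that the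
  integral of \<open>H'(u) W\<close> is at most \<open>3 \<epsilon>\<close> times the \<open>L\<^sup>1\<close> norm of \<open>\<Delta>f\<close>
  (lemma \<open>wronskian_integral_le\<close>); \<open>f\<close> is chosen among \<open>v\<close>, \<open>w\<close> as the function whose
  Laplacian is integrable. On a fixed ball where \<open>u\<close> and \<open>W\<close> are bounded below by positive
  constants, \<open>H'(u) \<ge> 1/4\<close> for all small \<open>\<epsilon>\<close>, so the left side stays away from zero as
  \<open>\<epsilon>\<close> tends to zero: a contradiction.

  The function \<open>H(s) = s (1 - \<epsilon>/s)\<^sup>3\<close>, continued by zero below \<open>\<epsilon>\<close>, has all these properties
  (lemmas \<open>DERIV_ramp\<close>, \<open>ramp_deriv_ge\<close>, \<open>ramp_defect\<close>). The divergence theorem for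
  compactly supported fields is reduced to one direction at a time, where it follows from the
  translation invariance of Lebesgue measure (lemma \<open>integral_directional_derivative_eq_0\<close>).
\<close>

section \<open>A smoothed positive part\<close>

text \<open>
  For \<open>e > 0\<close>, a convex \<open>C\<^sup>2\<close> approximation of the positive part that vanishes up to \<open>e\<close>. The cube makes it
  \<open>C\<^sup>2\<close> at \<open>e\<close>, and the division by \<open>s\<^sup>2\<close> makes it grow linearly, which is what keeps the defect
  \<open>s H'(s) - H(s)\<close> bounded. Writing it with \<open>max\<close> spares a case distinction; the value at
  \<open>s = 0\<close> is right because the numerator vanishes there.
\<close>
definition ramp :: "real \<Rightarrow> real \<Rightarrow> real" where
  "ramp e s = (max (s - e) 0) ^ 3 / s ^ 2"

definition ramp_deriv :: "real \<Rightarrow> real \<Rightarrow> real" where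
  "ramp_deriv e s = 3 * (max (s - e) 0) ^ 2 / s ^ 2 - 2 * (max (s - e) 0) ^ 3 / s ^ 3"

definition ramp_deriv2 :: "real \<Rightarrow> real \<Rightarrow> real" where
  "ramp_deriv2 e s = 6 * max (s - e) 0 * (s - max (s - e) 0) ^ 2 / s ^ 4"

lemma ramp_eq_0 [simp]:
  assumes "s \<le> e"
  shows "ramp e s = 0" "ramp_deriv e s = 0" "ramp_deriv2 e s = 0"
  using assms by (auto simp: ramp_def ramp_deriv_def ramp_deriv2_def max_def)

text \<open>Truncation at zero preserves differentiability of the powers of exponent at least two, since
  then the one-sided derivatives at the corner are both zero.\<close>
lemma DERIV_max_0_power:
  fixes s e :: real
  shows "((\<lambda>s. (max (s - e) 0) ^ (k + 2)) has_real_derivative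
           real (k + 2) * (max (s - e) 0) ^ (k + 1)) (at s)"
proof -
  consider "s < e" | "s > e" | "s = e" by linarith
  then show ?thesis
  proof cases
    case 1
    have "((\<lambda>_::real. 0::real) has_real_derivative 0) (at s)" by simp
    then have "((\<lambda>s. (max (s - e) 0) ^ (k + 2)) has_real_derivative 0) (at s)"
      by (rule has_field_derivative_transform_within_open[of _ _ _ "{..<e}"]) (use 1 in \<open>auto simp: max_def\<close>)
    then show ?thesis using 1 by (simp add: max_def)
  next
    case 2
    have "((\<lambda>s::real. (s - e) ^ (k + 2)) has_real_derivative real (k + 2) * (s - e) ^ (k + 1)) (at s)"
      by (rule DERIV_cong[OF DERIV_power[where D = 1]]) (auto intro!: derivative_eq_intros)
    then have "((\<lambda>s. (max (s - e) 0) ^ (k + 2)) has_real_derivative real (k + 2) * (s - e) ^ (k + 1)) (at s)"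
      by (rule has_field_derivative_transform_within_open[of _ _ _ "{e<..}"]) (use 2 in \<open>auto simp: max_def\<close>)
    then show ?thesis using 2 by (simp add: max_def)
  next
    case 3
    have "((\<lambda>h::real. (max h 0) ^ (k + 1)) \<longlongrightarrow> (max 0 0) ^ (k + 1)) (at 0)"
      by (intro tendsto_intros)
    moreover have "(max h 0) ^ (k + 2) / h = (max h 0) ^ (k + 1)" for h :: real
      by (auto simp: max_def)
    ultimately have "((\<lambda>h::real. (max h 0) ^ (k + 2) / h) \<longlongrightarrow> 0) (at 0)" by simp
    then show ?thesis using 3 by (simp add: DERIV_def)
  qed
qed

lemma DERIV_ramp:
  assumes "e > 0"
  shows "(ramp e has_real_derivative ramp_deriv e s) (at s)"
    and "(ramp_deriv e has_real_derivative ramp_deriv2 e s) (at s)"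
proof -
  define P where "P = (\<lambda>s. max (s - e) 0)"
  have P: "((\<lambda>s. P s ^ 2) has_real_derivative 2 * P s) (at s)"
    "((\<lambda>s. P s ^ 3) has_real_derivative 3 * P s ^ 2) (at s)"
    using DERIV_max_0_power[of e 0 s] DERIV_max_0_power[of e 1 s]
    by (simp_all add: P_def eval_nat_numeral)
  consider "s < e" | "s > 0" using assms by linarith
  then have "(ramp e has_real_derivative ramp_deriv e s) (at s) \<and> (ramp_deriv e has_real_derivative ramp_deriv2 e s) (at s)"
  proof cases
    case 1
    have z: "((\<lambda>_::real. 0::real) has_real_derivative 0) (at s)" by simp
    show ?thesis
      using 1 by (auto intro!: has_field_derivative_transform_within_open[OF z, of "{..<e}"])
  next
    case 2
    have quot: "((\<lambda>s. P s ^ Suc n / s ^ m) has_real_derivative (d * s - m * P s ^ Suc n) / s ^ Suc m) (at s)"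
      if "((\<lambda>s. P s ^ Suc n) has_real_derivative d) (at s)" for n m d
    proof (cases m)
      case 0
      then show ?thesis using that 2 by simp
    next
      case (Suc k)
      have "d * s ^ m - P s ^ Suc n * (real m * s ^ (m - Suc 0)) = s ^ k * (d * s - m * P s ^ Suc n)"
        using Suc by (simp add: right_diff_distrib mult_ac)
      moreover have "s ^ m * s ^ m = s ^ k * s ^ Suc m"
        using Suc by (simp add: mult_ac)
      ultimately show ?thesis
        using DERIV_divide[OF that DERIV_pow[of m s]] 2 by simp
    qed
    have "((\<lambda>s. P s ^ 3 / s ^ 2) has_real_derivative ramp_deriv e s) (at s)"
      using quot[of 2 "3 * P s ^ 2" 2] P(2) 2
      by (simp add: ramp_deriv_def P_def eval_nat_numeral diff_divide_distrib)
    moreover have "((\<lambda>s. 3 * (P s ^ 2 / s ^ 2) - 2 * (P s ^ 3 / s ^ 3)) has_real_derivative ramp_deriv2 e s) (at s)"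
    proof (rule DERIV_cong[OF DERIV_diff])
      show "((\<lambda>s. 3 * (P s ^ 2 / s ^ 2)) has_real_derivative 3 * ((2 * P s * s - 2 * P s ^ 2) / s ^ 3)) (at s)"
        using DERIV_cmult[OF quot[of 1 "2 * P s" 2], of 3] P(1) by (simp add: eval_nat_numeral)
      show "((\<lambda>s. 2 * (P s ^ 3 / s ^ 3)) has_real_derivative 2 * ((3 * P s ^ 2 * s - 3 * P s ^ 3) / s ^ 4)) (at s)"
        using DERIV_cmult[OF quot[of 2 "3 * P s ^ 2" 3], of 2] P(2) by (simp add: eval_nat_numeral)
      have s3: "x / s ^ 3 = x * s / s ^ 4" for x
        using 2 by (simp add: eval_nat_numeral)
      have "3 * ((2 * P s * s - 2 * P s ^ 2) * s) - 2 * (3 * P s ^ 2 * s - 3 * P s ^ 3) = 6 * P s * (s - P s) ^ 2"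
        by (simp add: algebra_simps eval_nat_numeral)
      then show "3 * ((2 * P s * s - 2 * P s ^ 2) / s ^ 3) - 2 * ((3 * P s ^ 2 * s - 3 * P s ^ 3) / s ^ 4)
          = ramp_deriv2 e s"
        unfolding s3 times_divide_eq_right diff_divide_distrib[symmetric] by (simp add: ramp_deriv2_def P_def)
    qed
    ultimately show ?thesis
      unfolding ramp_def[abs_def] ramp_deriv_def[abs_def] P_def by simp
  qed
  then show "(ramp e has_real_derivative ramp_deriv e s) (at s)"
    and "(ramp_deriv e has_real_derivative ramp_deriv2 e s) (at s)" by auto
qed

lemma continuous_on_ramp_deriv2:
  assumes "e > 0"
  shows "continuous_on UNIV (ramp_deriv2 e)"
proof -
  have 1: "continuous_on {..<e} (ramp_deriv2 e)"
    by (rule continuous_on_eq[of _ "\<lambda>_. 0"]) auto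
  have 2: "continuous_on {0<..} (ramp_deriv2 e)"
    unfolding ramp_deriv2_def[abs_def] by (intro continuous_intros) auto
  have "{..<e} \<union> {0<..} = UNIV" using assms by auto
  with continuous_on_open_Un[OF _ _ 1 2] show ?thesis by simp
qed

lemma ramp_deriv2_nonneg: "ramp_deriv2 e s \<ge> 0"
  by (auto simp: ramp_deriv2_def)

lemma ramp_deriv_nonneg: "e > 0 \<Longrightarrow> ramp_deriv e s \<ge> 0"
proof (cases "s \<le> e")
  case False
  assume "e > 0"
  then have "ramp_deriv e s = (s - e)^2 * (s + 2 * e) / s ^ 3"
    using False by (simp add: ramp_deriv_def max_def field_simps power2_eq_square power3_eq_cube)
  then show ?thesis using False \<open>e > 0\<close> by simp
qed simp

text \<open>The bound is not sharp; all that matters is a positive constant that does not depend on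
  \<open>e\<close>.\<close>
lemma ramp_deriv_ge:
  assumes "e > 0" "s \<ge> 2 * e"
  shows "ramp_deriv e s \<ge> 1 / 4"
proof -
  define r where "r = e / s"
  have r: "0 < r" "r \<le> 1/2" using assms by (auto simp: r_def field_simps)
  have "ramp_deriv e s = (1 - r)^2 * (1 + 2 * r)"
    using assms by (simp add: ramp_deriv_def r_def max_def field_simps power2_eq_square power3_eq_cube)
  also have "\<dots> \<ge> (1/2)^2 * 1"
    using r by (intro mult_mono power_mono) auto
  finally show ?thesis by (simp add: power2_eq_square)
qed

text \<open>The defect is zero for functions homogeneous of degree one. It measures by how much
  Green's identity for the smoothed positive part differs from the one for \<open>u\<close> itself, and this
  bound makes the difference disappear as \<open>e\<close> tends to zero.\<close>
lemma ramp_defect: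
  assumes "e > 0"
  shows "\<bar>s * ramp_deriv e s - ramp e s\<bar> \<le> 3 * e"
proof (cases "s \<le> e")
  case False
  have "s * ramp_deriv e s - ramp e s = 3 * e * ((s - e) / s) ^ 2"
    using False assms by (simp add: ramp_deriv_def ramp_def max_def field_simps power2_eq_square power3_eq_cube)
  moreover have "((s - e) / s) ^ 2 \<le> 1 ^ 2"
    using False assms by (intro power_mono) (auto simp: field_simps)
  ultimately show ?thesis using assms by (simp add: abs_mult)
qed (use assms in auto)

section \<open>Divergence theorem for compactly supported functions\<close>

text \<open>By translation invariance, each difference quotient of \<open>F\<close> in the direction \<open>b\<close> has
  integral zero. The quotients converge to \<open>G\<close>, and by the mean value theorem they are dominated
  by a multiple of the indicator of a compact set.\<close>
lemma integral_directional_derivative_eq_0: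
  fixes F G :: "'a::euclidean_space \<Rightarrow> real"
  assumes der: "\<And>x. ((\<lambda>t. F (x + t *\<^sub>R b)) has_real_derivative G x) (at 0)"
    and contF: "continuous_on UNIV F" and contG: "continuous_on UNIV G"
    and K: "compact K" and F0: "\<And>x. x \<notin> K \<Longrightarrow> F x = 0" and G0: "\<And>x. x \<notin> K \<Longrightarrow> G x = 0"
  shows "integrable lborel G" "integral\<^sup>L lborel G = 0"
proof -
  have cs: "integrable lborel g" if "continuous_on UNIV g" "\<And>x. x \<notin> K \<Longrightarrow> g x = 0" for g :: "'a \<Rightarrow> real"
  proof -
    have "integrable lborel (\<lambda>x. indicator K x *\<^sub>R g x)"
      using K that(1) by (intro borel_integrable_compact) (auto intro: continuous_on_subset)
    also have "(\<lambda>x. indicator K x *\<^sub>R g x) = g"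
      using that(2) by (auto simp: indicator_def fun_eq_iff)
    finally show ?thesis .
  qed
  show "integrable lborel G" using cs contG G0 by auto
  have intF: "integrable lborel F" using cs contF F0 by auto
  have der': "((\<lambda>t. F (x + t *\<^sub>R b)) has_real_derivative G (x + s *\<^sub>R b)) (at s)" for x s
  proof -
    have "((\<lambda>t. F ((x + s *\<^sub>R b) + (t - s) *\<^sub>R b)) has_real_derivative G (x + s *\<^sub>R b) * 1) (at s)"
      by (rule DERIV_chain'[of "\<lambda>t. t - s" 1 s UNIV "\<lambda>t. F ((x + s *\<^sub>R b) + t *\<^sub>R b)"])
         (use der in \<open>auto intro!: derivative_eq_intros\<close>)
    then show ?thesis by (simp add: algebra_simps)
  qed
  obtain M where M: "\<And>x. \<bar>G x\<bar> \<le> M"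
  proof -
    have "bounded (G ` K)"
      using K contG by (intro compact_imp_bounded compact_continuous_image) (auto intro: continuous_on_subset)
    then obtain M where "\<And>x. x \<in> K \<Longrightarrow> \<bar>G x\<bar> \<le> M" by (auto simp: bounded_iff)
    then have "\<bar>G x\<bar> \<le> max M 0" for x using G0[of x] by (cases "x \<in> K") (auto simp: le_max_iff_disj)
    then show ?thesis using that by blast
  qed
  define h where "h n = 1 / real (Suc n)" for n
  have h: "0 < h n" "h n \<le> 1" for n by (auto simp: h_def field_simps)
  define Q where "Q n x = (F (x + h n *\<^sub>R b) - F x) / h n" for n x
  \<comment> \<open>The quotients with step at most one all vanish outside the sweep of \<open>K\<close> along \<open>-b\<close>.\<close>
  define K' where "K' = (\<lambda>(x, t). x - t *\<^sub>R b) ` (K \<times> {0..1::real})"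
  have K': "compact K'"
    unfolding K'_def case_prod_beta by (intro compact_continuous_image continuous_intros compact_Times K) auto
  have Q_bound: "norm (Q n x) \<le> M * indicator K' x" for n x
  proof (cases "x \<in> K'")
    case True
    obtain z where "F (x + h n *\<^sub>R b) - F (x + 0 *\<^sub>R b) = (h n - 0) * G (x + z *\<^sub>R b)"
      using MVT2[of 0 "h n" "\<lambda>t. F (x + t *\<^sub>R b)" "\<lambda>s. G (x + s *\<^sub>R b)"] der' h by blast
    then have "Q n x = G (x + z *\<^sub>R b)" using h[of n] by (simp add: Q_def)
    then show ?thesis using M True by simp
  next
    case False
    have "x + t *\<^sub>R b \<notin> K" if "0 \<le> t" "t \<le> 1" for t
    proof
      assume "x + t *\<^sub>R b \<in> K"
      then have "x \<in> K'" unfolding K'_def using that by (intro image_eqI[of _ _ "(x + t *\<^sub>R b, t)"]) auto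
      with False show False by simp
    qed
    from this[of 0] this[of "h n"] h[of n] have "Q n x = 0" by (simp add: Q_def F0)
    with False show ?thesis by simp
  qed
  have intshift: "integrable lborel (\<lambda>x. F (x + a))" "(\<integral>x. F (x + a) \<partial>lborel) = (\<integral>x. F x \<partial>lborel)" for a
  proof -
    have "integrable (distr lborel borel ((+) a)) F" using intF lborel_distr_plus[of a] by simp
    then show "integrable lborel (\<lambda>x. F (x + a))"
      by (subst (asm) integrable_distr_eq) (use intF in \<open>auto simp: add.commute\<close>)
    have "(\<integral>x. F x \<partial>lborel) = (\<integral>x. F x \<partial>(distr lborel borel ((+) a)))" using lborel_distr_plus[of a] by simp
    also have "\<dots> = (\<integral>x. F (x + a) \<partial>lborel)"
      by (subst integral_distr) (use intF in \<open>auto simp: add.commute\<close>)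
    finally show "(\<integral>x. F (x + a) \<partial>lborel) = (\<integral>x. F x \<partial>lborel)" by simp
  qed
  have intQ: "integral\<^sup>L lborel (Q n) = 0" for n
    unfolding Q_def using intshift[of "h n *\<^sub>R b"] intF by simp
  have "(\<lambda>n. integral\<^sup>L lborel (Q n)) \<longlonglongrightarrow> integral\<^sup>L lborel G"
  proof (rule integral_dominated_convergence[where w = "\<lambda>x. M * indicator K' x"])
    show "G \<in> borel_measurable lborel" using \<open>integrable lborel G\<close> by auto
    show "Q n \<in> borel_measurable lborel" for n
      unfolding Q_def using intshift(1)[of "h n *\<^sub>R b"] intF by measurable
    show "integrable lborel (\<lambda>x. M * indicator K' x)"
      using borel_integrable_compact[OF K', of "\<lambda>_. M"] by (simp add: mult.commute)
    show "AE x in lborel. norm (Q n x) \<le> M * indicator K' x" for n using Q_bound by simp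
    have "(\<lambda>n. Q n x) \<longlonglongrightarrow> G x" for x
    proof -
      have "((\<lambda>t. (F (x + t *\<^sub>R b) - F x) / t) \<longlongrightarrow> G x) (at 0)"
        using der[of x] by (simp add: DERIV_def)
      moreover have "filterlim h (at 0) sequentially"
        unfolding filterlim_at using h LIMSEQ_inverse_real_of_nat
        by (auto simp: h_def[abs_def] inverse_eq_divide)
      ultimately show ?thesis unfolding Q_def by (rule filterlim_compose)
    qed
    then show "AE x in lborel. (\<lambda>n. Q n x) \<longlonglongrightarrow> G x" by simp
  qed
  then show "integral\<^sup>L lborel G = 0" by (simp add: intQ LIMSEQ_const_iff)
qed

section \<open>Green's identity for the smoothed positive part\<close>

text \<open>
  The integrand is the contribution of one direction \<open>b\<close> to the divergence of
  \<open>f \<nabla>(ramp e \<circ> u) - (ramp e \<circ> u) \<nabla>f\<close>; the two terms with a product of first derivatives of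
  \<open>f\<close> and \<open>u\<close> cancel. The first and second derivatives enter as arbitrary functions, so that the
  lemma applies to \<open>u = v - w\<close> without computing the partial derivatives of a difference. Because
  \<open>u \<le> 0\<close> on the frontier, everything vanishes outside the compact set where \<open>u \<ge> e\<close>, and
  extension by zero gives functions on the whole space.
\<close>
lemma integral_green_ramp_eq_0:
  fixes u du ddu f df ddf :: "'a::euclidean_space \<Rightarrow> real"
  assumes "e > 0" and \<Omega>: "open \<Omega>" "bounded \<Omega>"
    and u: "continuous_on (closure \<Omega>) u" "\<And>x. x \<in> frontier \<Omega> \<Longrightarrow> u x \<le> 0"
    and cont: "continuous_on \<Omega> f" "continuous_on \<Omega> du" "continuous_on \<Omega> df"
              "continuous_on \<Omega> ddu" "continuous_on \<Omega> ddf"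
    and der: "\<And>x. x \<in> \<Omega> \<Longrightarrow> ((\<lambda>t. u (x + t *\<^sub>R b)) has_real_derivative du x) (at 0)"
             "\<And>x. x \<in> \<Omega> \<Longrightarrow> ((\<lambda>t. du (x + t *\<^sub>R b)) has_real_derivative ddu x) (at 0)"
             "\<And>x. x \<in> \<Omega> \<Longrightarrow> ((\<lambda>t. f (x + t *\<^sub>R b)) has_real_derivative df x) (at 0)"
             "\<And>x. x \<in> \<Omega> \<Longrightarrow> ((\<lambda>t. df (x + t *\<^sub>R b)) has_real_derivative ddf x) (at 0)"
  defines "G \<equiv> \<lambda>x. f x * (ramp_deriv e (u x) * ddu x + ramp_deriv2 e (u x) * (du x)\<^sup>2) - ramp e (u x) * ddf x"
  shows "integrable lborel (\<lambda>x. if x \<in> \<Omega> then G x else 0)"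
    and "(\<integral>x. (if x \<in> \<Omega> then G x else 0) \<partial>lborel) = 0"
proof -
  define K where "K = {x \<in> closure \<Omega>. e \<le> u x}"
  have "closed K"
    unfolding K_def by (rule continuous_on_closed_Collect_le) (use u(1) in \<open>auto intro: continuous_intros\<close>)
  moreover have "bounded K"
    using \<Omega>(2) by (rule bounded_subset[OF bounded_closure]) (auto simp: K_def)
  ultimately have K: "compact K" by (simp add: compact_eq_bounded_closed)
  have K\<Omega>: "K \<subseteq> \<Omega>"
  proof
    fix x assume x: "x \<in> K"
    then have "x \<notin> frontier \<Omega>" using u(2)[of x] \<open>e > 0\<close> by (auto simp: K_def)
    with x show "x \<in> \<Omega>" using \<Omega>(1) by (auto simp: K_def frontier_def interior_open)
  qed
  have cont_glue: "continuous_on UNIV (\<lambda>x. if x \<in> \<Omega> then g x else 0)"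
    if "continuous_on \<Omega> g" "\<And>x. x \<in> \<Omega> - K \<Longrightarrow> g x = 0" for g :: "'a \<Rightarrow> real"
  proof -
    have "continuous_on \<Omega> (\<lambda>x. if x \<in> \<Omega> then g x else 0)"
      using that(1) by (rule continuous_on_eq) auto
    moreover have "continuous_on (-K) (\<lambda>x. if x \<in> \<Omega> then g x else 0)"
      by (rule continuous_on_eq[of _ "\<lambda>_. 0"]) (use that(2) in auto)
    ultimately have "continuous_on (\<Omega> \<union> -K) (\<lambda>x. if x \<in> \<Omega> then g x else 0)"
      using \<Omega>(1) \<open>closed K\<close> by (intro continuous_on_open_Un) auto
    moreover have "\<Omega> \<union> -K = UNIV" using K\<Omega> by auto
    ultimately show ?thesis by simp
  qed
  have off: "u x \<le> e" if "x \<in> \<Omega> - K" for x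
    using that closure_subset[of \<Omega>] by (auto simp: K_def)
  define F where "F x = f x * ramp_deriv e (u x) * du x - ramp e (u x) * df x" for x
  have cont_ramp: "continuous_on UNIV (ramp e)" "continuous_on UNIV (ramp_deriv e)"
    using DERIV_ramp[OF \<open>e > 0\<close>] by (auto intro!: continuous_at_imp_continuous_on DERIV_isCont)
  have contu: "continuous_on \<Omega> u" using u(1) closure_subset by (rule continuous_on_subset)
  have cont_comp: "continuous_on \<Omega> (\<lambda>x. ramp e (u x))" "continuous_on \<Omega> (\<lambda>x. ramp_deriv e (u x))"
      "continuous_on \<Omega> (\<lambda>x. ramp_deriv2 e (u x))"
    using cont_ramp continuous_on_ramp_deriv2[OF \<open>e > 0\<close>] contu
    by (auto intro: continuous_on_compose2)
  have contF: "continuous_on UNIV (\<lambda>x. if x \<in> \<Omega> then F x else 0)"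
    unfolding F_def by (rule cont_glue) (use off in \<open>auto intro!: continuous_intros cont cont_comp\<close>)
  have contG: "continuous_on UNIV (\<lambda>x. if x \<in> \<Omega> then G x else 0)"
    unfolding G_def by (rule cont_glue) (use off in \<open>auto intro!: continuous_intros cont cont_comp\<close>)
  have derF: "((\<lambda>t. if x + t *\<^sub>R b \<in> \<Omega> then F (x + t *\<^sub>R b) else 0) has_real_derivative
                (if x \<in> \<Omega> then G x else 0)) (at 0)" for x
  proof (cases "x \<in> \<Omega>")
    case True
    have ev: "open ((\<lambda>t. x + t *\<^sub>R b) -` \<Omega>)"
      using \<Omega>(1) by (intro open_vimage continuous_intros)
    have r: "((\<lambda>t. ramp e (u (x + t *\<^sub>R b))) has_real_derivative ramp_deriv e (u x) * du x) (at 0)"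
        "((\<lambda>t. ramp_deriv e (u (x + t *\<^sub>R b))) has_real_derivative ramp_deriv2 e (u x) * du x) (at 0)"
      using DERIV_chain2[OF _ der(1)[OF True], of "ramp e" "ramp_deriv e (u x)"]
        DERIV_chain2[OF _ der(1)[OF True], of "ramp_deriv e" "ramp_deriv2 e (u x)"] DERIV_ramp[OF \<open>e > 0\<close>]
      by auto
    have "((\<lambda>t. F (x + t *\<^sub>R b)) has_real_derivative G x) (at 0)"
      unfolding F_def by (rule derivative_eq_intros der(2-)[OF True] r refl)+
         (simp add: G_def algebra_simps power2_eq_square)
    then have "((\<lambda>t. if x + t *\<^sub>R b \<in> \<Omega> then F (x + t *\<^sub>R b) else 0) has_real_derivative G x) (at 0)"
      by (rule has_field_derivative_transform_within_open[OF _ ev]) (use True in auto)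
    then show ?thesis using True by simp
  next
    case False
    have ev: "open ((\<lambda>t. x + t *\<^sub>R b) -` (-K))"
      using \<open>closed K\<close> by (intro open_vimage continuous_intros) auto
    have "((\<lambda>_::real. 0::real) has_real_derivative 0) (at 0)" by simp
    then have "((\<lambda>t. if x + t *\<^sub>R b \<in> \<Omega> then F (x + t *\<^sub>R b) else 0) has_real_derivative 0) (at 0)"
      by (rule has_field_derivative_transform_within_open[OF _ ev]) (use False K\<Omega> off in \<open>auto simp: F_def\<close>)
    then show ?thesis using False by simp
  qed
  show "integrable lborel (\<lambda>x. if x \<in> \<Omega> then G x else 0)"
    and "(\<integral>x. (if x \<in> \<Omega> then G x else 0) \<partial>lborel) = 0"
    using integral_directional_derivative_eq_0[OF derF contF contG K] off
    by (auto simp: F_def G_def)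
qed

section \<open>The key inequality\<close>
lemma Ck_on_2_directional_derivatives:
  fixes f :: "'a::euclidean_space \<Rightarrow> real"
  assumes "Ck_on 2 \<Omega> f" "b \<in> Basis"
  defines "D \<equiv> partial_derivative b f" and "DD \<equiv> partial_derivative b (partial_derivative b f)"
  shows "continuous_on \<Omega> f" "continuous_on \<Omega> D" "continuous_on \<Omega> DD"
    "\<And>x. x \<in> \<Omega> \<Longrightarrow> ((\<lambda>t. f (x + t *\<^sub>R b)) has_real_derivative D x) (at 0)"
    "\<And>x. x \<in> \<Omega> \<Longrightarrow> ((\<lambda>t. D (x + t *\<^sub>R b)) has_real_derivative DD x) (at 0)"
proof -
  have d: "f differentiable (at x)" "D differentiable (at x)" if "x \<in> \<Omega>" for x
    using assms that by (auto simp: numeral_2_eq_2)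
  have dir: "((\<lambda>t. g (x + t *\<^sub>R b)) has_real_derivative partial_derivative b g x) (at 0)"
    if "g differentiable (at x)" for x and g :: "'a \<Rightarrow> real"
  proof -
    have g: "(g has_derivative frechet_derivative g (at x)) (at x)"
      using that by (simp add: frechet_derivative_works)
    have "((\<lambda>t. g (x + t *\<^sub>R b)) has_derivative (\<lambda>t. frechet_derivative g (at x) (t *\<^sub>R b))) (at 0)"
      by (rule has_derivative_compose[of "\<lambda>t. x + t *\<^sub>R b" "\<lambda>t. t *\<^sub>R b" 0 UNIV g])
         (use g in \<open>auto intro!: derivative_eq_intros\<close>)
    moreover have "frechet_derivative g (at x) (t *\<^sub>R b) = partial_derivative b g x * t" for t
      using linear_scale[OF has_derivative_linear[OF g]] by (simp add: partial_derivative_def)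
    ultimately show ?thesis by (simp add: has_field_derivative_def)
  qed
  show "continuous_on \<Omega> f" "continuous_on \<Omega> D"
    using d by (auto intro!: continuous_at_imp_continuous_on differentiable_imp_continuous_within)
  show "continuous_on \<Omega> DD" using assms by (auto simp: numeral_2_eq_2)
  show "((\<lambda>t. f (x + t *\<^sub>R b)) has_real_derivative D x) (at 0)" if "x \<in> \<Omega>" for x
    using dir d that by (simp add: D_def)
  show "((\<lambda>t. D (x + t *\<^sub>R b)) has_real_derivative DD x) (at 0)" if "x \<in> \<Omega>" for x
    using dir[of D x] d that by (simp add: D_def DD_def)
qed

lemma continuous_on_laplacian:
  fixes f :: "'a::euclidean_space \<Rightarrow> real"
  assumes "Ck_on 2 \<Omega> f"
  shows "continuous_on \<Omega> (laplacian f)"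
  unfolding laplacian_def[abs_def] using Ck_on_2_directional_derivatives(3)[OF assms] by (intro continuous_intros) auto

text \<open>
  This is Kato's argument. Summing Green's identity over all directions and dropping the nonnegative
  gradient term leaves the integral of \<open>ramp_deriv e u * (w \<Delta>v - v \<Delta>w)\<close> plus the defect times
  \<open>\<Delta>f\<close>. The identity \<open>f \<Delta>u - u \<Delta>f = w \<Delta>v - v \<Delta>w\<close> holds for either choice of \<open>f\<close>, so
  integrability of one of the two Laplacians is enough. The left side is localised to a set \<open>B\<close>
  with a constant lower bound for the integrand, which avoids a passage to the limit under the
  integral sign when \<open>e\<close> tends to zero.
\<close>
lemma wronskian_integral_le:
  fixes f v w :: "'a::euclidean_space \<Rightarrow> real"
  assumes e: "e > 0" and \<Omega>: "open \<Omega>" "bounded \<Omega>"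
    and v: "Ck_on 2 \<Omega> v" "continuous_on (closure \<Omega>) v"
    and w: "Ck_on 2 \<Omega> w" "continuous_on (closure \<Omega>) w"
    and bdry: "\<And>x. x \<in> frontier \<Omega> \<Longrightarrow> v x \<le> w x"
    and f: "f = v \<or> f = w" and fpos: "\<And>x. x \<in> \<Omega> \<Longrightarrow> f x > 0"
    and int: "laplacian f absolutely_integrable_on \<Omega>"
    and B: "B \<in> lmeasurable" "B \<subseteq> \<Omega>"
    and low: "\<And>x. x \<in> B \<Longrightarrow> c \<le> ramp_deriv e (v x - w x) * (w x * laplacian v x - v x * laplacian w x)"
    and nonneg: "\<And>x. x \<in> \<Omega> \<Longrightarrow> 0 \<le> ramp_deriv e (v x - w x) * (w x * laplacian v x - v x * laplacian w x)"
  shows "c * measure lebesgue B \<le> 3 * e * integral \<Omega> (\<lambda>x. \<bar>laplacian f x\<bar>)"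
proof -
  define u where "u x = v x - w x" for x
  have f2: "Ck_on 2 \<Omega> f" using f v w by auto
  define D where "D b x = partial_derivative b v x - partial_derivative b w x" for b x
  define DD where "DD b x = partial_derivative b (partial_derivative b v) x
     - partial_derivative b (partial_derivative b w) x" for b x
  define G where "G b x = f x * (ramp_deriv e (u x) * DD b x + ramp_deriv2 e (u x) * (D b x)\<^sup>2)
     - ramp e (u x) * partial_derivative b (partial_derivative b f) x" for b x
  have G: "integrable lborel (\<lambda>x. if x \<in> \<Omega> then G b x else 0)"
    "(\<integral>x. (if x \<in> \<Omega> then G b x else 0) \<partial>lborel) = 0" if b: "b \<in> Basis" for b
  proof -
    note V = Ck_on_2_directional_derivatives[OF v(1) b] and W = Ck_on_2_directional_derivatives[OF w(1) b] and FF = Ck_on_2_directional_derivatives[OF f2 b]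
    have "continuous_on (closure \<Omega>) u" unfolding u_def by (intro continuous_intros v w)
    moreover have "u x \<le> 0" if "x \<in> frontier \<Omega>" for x using bdry[OF that] by (simp add: u_def)
    moreover have "continuous_on \<Omega> (D b)" "continuous_on \<Omega> (DD b)"
      unfolding D_def DD_def by (intro continuous_intros V W)+
    moreover have "((\<lambda>t. u (x + t *\<^sub>R b)) has_real_derivative D b x) (at 0)"
        "((\<lambda>t. D b (x + t *\<^sub>R b)) has_real_derivative DD b x) (at 0)" if "x \<in> \<Omega>" for x
      unfolding u_def D_def DD_def using that by (auto intro!: DERIV_diff V W)
    ultimately show "integrable lborel (\<lambda>x. if x \<in> \<Omega> then G b x else 0)"
      "(\<integral>x. (if x \<in> \<Omega> then G b x else 0) \<partial>lborel) = 0"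
      unfolding G_def using integral_green_ramp_eq_0[OF e \<Omega>, of u f "D b" _ "DD b"] FF by blast+
  qed
  define S where "S x = (\<Sum>b\<in>Basis. if x \<in> \<Omega> then G b x else 0)" for x
  have "integrable lborel S" "integral\<^sup>L lborel S = 0"
    unfolding S_def using G by (auto simp: Bochner_Integration.integral_sum)
  then have S: "integrable lebesgue S" "integral\<^sup>L lebesgue S = 0"
    by (auto simp: integrable_completion integral_completion)
  have S_ge: "c * indicator B x - 3 * e * (indicator \<Omega> x * \<bar>laplacian f x\<bar>) \<le> S x" for x
  proof (cases "x \<in> \<Omega>")
    case True
    let ?L = "\<lambda>g. laplacian g x"
    let ?W = "w x * ?L v - v x * ?L w"
    have "S x = f x * (ramp_deriv e (u x) * (?L v - ?L w)) + f x * ramp_deriv2 e (u x) * (\<Sum>b\<in>Basis. (D b x)\<^sup>2)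
       - ramp e (u x) * ?L f"
      using True by (simp add: S_def G_def DD_def laplacian_def sum.distrib sum_subtractf
          sum_distrib_left algebra_simps)
    also have "\<dots> \<ge> f x * (ramp_deriv e (u x) * (?L v - ?L w)) - ramp e (u x) * ?L f"
      using fpos[OF True] ramp_deriv2_nonneg by (simp add: sum_nonneg)
    also have "f x * (ramp_deriv e (u x) * (?L v - ?L w)) - ramp e (u x) * ?L f
       = ramp_deriv e (u x) * ?W + (u x * ramp_deriv e (u x) - ramp e (u x)) * ?L f"
      using f by (auto simp: u_def algebra_simps)
    also have "\<dots> \<ge> ramp_deriv e (u x) * ?W - 3 * e * \<bar>?L f\<bar>"
    proof -
      have "\<bar>(u x * ramp_deriv e (u x) - ramp e (u x)) * ?L f\<bar> \<le> 3 * e * \<bar>?L f\<bar>"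
        unfolding abs_mult by (intro mult_right_mono ramp_defect e) auto
      then show ?thesis by linarith
    qed
    finally have "ramp_deriv e (u x) * ?W - 3 * e * \<bar>?L f\<bar> \<le> S x" by simp
    moreover have "c * indicator B x \<le> ramp_deriv e (u x) * ?W"
      using low[of x] nonneg[OF True] by (auto simp: u_def indicator_def)
    ultimately show ?thesis using True by simp
  next
    case False
    then show ?thesis using B by (auto simp: S_def indicator_def)
  qed
  have L: "integrable lebesgue (\<lambda>x. indicator \<Omega> x * \<bar>laplacian f x\<bar>)"
    using set_integrable_abs[OF int] by (simp add: set_integrable_def)
  have Leq: "(\<integral>x. indicator \<Omega> x * \<bar>laplacian f x\<bar> \<partial>lebesgue) = integral \<Omega> (\<lambda>x. \<bar>laplacian f x\<bar>)"
    using set_lebesgue_integral_eq_integral(2)[OF set_integrable_abs[OF int]]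
    by (simp add: set_lebesgue_integral_def)
  have I: "integrable lebesgue (indicator B :: 'a \<Rightarrow> real)"
    using B(1) by (simp add: lmeasurable_iff_integrable)
  have "(\<integral>x. c * indicator B x - 3 * e * (indicator \<Omega> x * \<bar>laplacian f x\<bar>) \<partial>lebesgue) \<le> integral\<^sup>L lebesgue S"
    by (rule integral_mono) (use I L S S_ge in auto)
  then show ?thesis using I L S Leq B by simp
qed

section \<open>The comparison principle\<close>
theorem lemma2p1:
  fixes \<Omega> :: "(real ^ 'n) set"
    and \<Psi> :: "real ^ 'n \<Rightarrow> real \<Rightarrow> real"
    and v w :: "real ^ 'n \<Rightarrow> real"
  assumes "CARD('n) \<ge> 2"
    and "smooth_bounded_domain \<Omega>"
    and "continuous_on (closure \<Omega> \<times> {0<..}) (\<lambda>(x, s). \<Psi> x s)"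
    and "\<And>x. x \<in> \<Omega> \<Longrightarrow> strict_antimono_on {0<..} (\<lambda>s. \<Psi> x s / s)"
    and "Ck_on 2 \<Omega> v" and "continuous_on (closure \<Omega>) v"
    and "Ck_on 2 \<Omega> w" and "continuous_on (closure \<Omega>) w"
    and "\<And>x. x \<in> \<Omega> \<Longrightarrow> laplacian w x + \<Psi> x (w x) \<le> 0"
    and "\<And>x. x \<in> \<Omega> \<Longrightarrow> 0 \<le> laplacian v x + \<Psi> x (v x)"
    and "\<And>x. x \<in> \<Omega> \<Longrightarrow> v x > 0" and "\<And>x. x \<in> \<Omega> \<Longrightarrow> w x > 0"
    and "\<And>x. x \<in> frontier \<Omega> \<Longrightarrow> v x \<le> w x"
    and "laplacian v absolutely_integrable_on \<Omega> \<or> laplacian w absolutely_integrable_on \<Omega>"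
  shows "\<forall>x\<in>\<Omega>. v x \<le> w x"
proof (rule ccontr)
  assume "\<not> (\<forall>x\<in>\<Omega>. v x \<le> w x)"
  then obtain p where p: "p \<in> \<Omega>" "v p > w p" by force
  have \<Omega>: "open \<Omega>" "bounded \<Omega>" using assms(2) by (auto simp: smooth_bounded_domain_def)
  define W where "W x = w x * laplacian v x - v x * laplacian w x" for x
  have W_pos: "W x > 0" if x: "x \<in> \<Omega>" "v x > w x" for x
  proof -
    have "\<Psi> x (v x) / v x < \<Psi> x (w x) / w x"
      using monotone_onD[OF assms(4)[OF x(1)], of "w x" "v x"] assms(11,12)[OF x(1)] x(2) by auto
    then have "w x * \<Psi> x (v x) < v x * \<Psi> x (w x)"
      using assms(11,12)[OF x(1)] by (simp add: field_simps)
    moreover have "w x * laplacian v x \<ge> w x * (- \<Psi> x (v x))"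
      using assms(10,12)[OF x(1)] by (intro mult_left_mono) auto
    moreover have "v x * laplacian w x \<le> v x * (- \<Psi> x (w x))"
      using assms(9,11)[OF x(1)] by (intro mult_left_mono) auto
    ultimately show ?thesis by (simp add: W_def)
  qed
  have cont: "continuous_on \<Omega> v" "continuous_on \<Omega> w"
    using assms(6,8) closure_subset by (auto intro: continuous_on_subset)
  have contW: "continuous_on \<Omega> W"
    unfolding W_def by (intro continuous_intros cont continuous_on_laplacian assms)
  define m where "m = (v p - w p) / 2"
  define c where "c = W p / 2"
  have mc: "m > 0" "c > 0" using p W_pos[OF p] by (auto simp: m_def c_def)
  define U where "U = {x \<in> \<Omega>. m < v x - w x} \<inter> {x \<in> \<Omega>. c < W x}"
  have "open (\<Omega> \<inter> (\<lambda>x. v x - w x) -` {m<..})" "open (\<Omega> \<inter> W -` {c<..})"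
    using \<Omega>(1) cont contW by (auto intro!: continuous_open_preimage continuous_intros)
  then have "open U" unfolding U_def by (intro open_Int) (auto simp: vimage_def Collect_conj_eq)
  moreover have "p \<in> U" using p mc by (auto simp: U_def m_def c_def)
  ultimately obtain r where r: "r > 0" "ball p r \<subseteq> U" by (auto simp: open_contains_ball)
  obtain f where f: "f = v \<or> f = w" "laplacian f absolutely_integrable_on \<Omega>" using assms(14) by auto
  define A where "A = integral \<Omega> (\<lambda>x. \<bar>laplacian f x\<bar>)"
  \<comment> \<open>The left side does not depend on \<open>e\<close>, while the right side tends to zero with \<open>e\<close>.\<close>
  have bound: "c / 4 * measure lebesgue (ball p r) \<le> 3 * e * A" if e: "0 < e" "2 * e \<le> m" for e
    unfolding A_def
  proof (rule wronskian_integral_le[OF e(1) \<Omega> assms(5-8,13) f(1) _ f(2)])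
    show "f x > 0" if "x \<in> \<Omega>" for x using f(1) assms(11,12)[OF that] by auto
    show "ball p r \<subseteq> \<Omega>" using r by (auto simp: U_def)
    show "c / 4 \<le> ramp_deriv e (v x - w x) * (w x * laplacian v x - v x * laplacian w x)"
      if "x \<in> ball p r" for x
    proof -
      have "x \<in> U" using r that by auto
      then have "1/4 * c \<le> ramp_deriv e (v x - w x) * W x"
        using e mc by (intro mult_mono ramp_deriv_ge ramp_deriv_nonneg) (auto simp: U_def)
      then show ?thesis by (simp add: W_def)
    qed
    show "0 \<le> ramp_deriv e (v x - w x) * (w x * laplacian v x - v x * laplacian w x)" if "x \<in> \<Omega>" for x
      using W_pos[OF that] ramp_deriv_nonneg[OF e(1), of "v x - w x"] e(1)
      by (cases "v x > w x") (auto simp: W_def)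
  qed auto
  have pos: "c / 4 * measure lebesgue (ball p r) > 0"
    using mc content_ball_pos[OF r(1), of p] by simp
  have "A \<ge> 0" unfolding A_def
    using set_lebesgue_integral_eq_integral(1)[OF set_integrable_abs[OF f(2)]] by (simp add: integral_nonneg)
  \<comment> \<open>The summand one in the denominator covers the case \<open>A = 0\<close>.\<close>
  define e where "e = min (m / 2) (c / 4 * measure lebesgue (ball p r) / (6 * (A + 1)))"
  have e: "0 < e" "2 * e \<le> m" using mc pos \<open>A \<ge> 0\<close> by (auto simp: e_def)
  have "e \<le> c / 4 * measure lebesgue (ball p r) / (6 * (A + 1))" by (simp add: e_def)
  then have "3 * e * (A + 1) \<le> c / 4 * measure lebesgue (ball p r) / 2"
    using \<open>A \<ge> 0\<close> by (simp add: field_simps)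
  with bound[OF e] pos e(1) show False by (simp add: algebra_simps)
qed

end
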